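(* Let $\mu=\mathrm{e}^{-\beta V}$ and $\rho=\mathrm{e}^{-\alpha\beta}\in(0,1)$ with $\beta>0$, $\alpha>0$, $V\in\mathbb{R}$. Let $Q_N$ be the conditional product moment polynomials of the auxiliary Gaussian Markov chain of the one-dimensional Manhattan elastic dimer-monomer system, and let $$T_N(t):=\sum_{k=0}^{N}\langle Q_N,h_k\rangle\frac{t^k}{\sqrt{k!}}=\mathrm{e}^{-t^2/2}\,\mathbf{E}\big(Q_N(X)\mathrm{e}^{tX}\big),\qquad t\in\mathbb{R},$$ where $X$ is a standard normal random variable (with $Q_N$, $h_k$ and $\langle\cdot,\cdot\rangle$ as defined in the context). Then for every integer $N\geq0$, the polynomials $T_N$ satisfy the recurrence equation $$T_{N+1}(t)=(\mu+t)\,T_N(\rho t)+\rho\,T_N'(\rho t)=\mathrm{e}^{-(\mu+t)^2/2}\,\frac{\mathrm{d}}{\mathrm{d}t}\Big(T_N(\rho t)\,\mathrm{e}^{(\mu+t)^2/2}\Big),$$ where $T_N'(\rho t)$ denotes the derivative of $T_N$ evaluated at $\rho t$.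
   Context: Let $\gamma:=\sqrt{1-\rho^2}$. The auxiliary sequence is $\xi_k:=\mu+\sigma_k$, $k\geq0$, where $\sigma_{k+1}=\rho\sigma_k+\gamma w_k$ and $\sigma_0,w_0,w_1,w_2,\ldots$ are independent standard normal random variables. For $N\geq0$, the function $Q_N:\mathbb{R}\to\mathbb{R}$ is defined by $$Q_N(\sigma_0):=\mathbf{E}\Big(\prod_{k=0}^{N-1}\xi_k\,\Big|\,\sigma_0\Big),\qquad Q_0\equiv1.$$ It is a polynomial of degree $N$, and $Q_{N+1}(\sigma_0)=(\mu+\sigma_0)\,\mathbf{E}(Q_N(\sigma_1)\mid\sigma_0)$. The Hermite polynomials are $H_k(x):=(-1)^k\mathrm{e}^{x^2/2}\frac{\mathrm{d}^k}{\mathrm{d}x^k}\mathrm{e}^{-x^2/2}$ and $h_k:=H_k/\sqrt{k!}$. The inner product is $\langle f,g\rangle:=\int_{\mathbb{R}}f(x)g(x)\frac{\mathrm{e}^{-x^2/2}}{\sqrt{2\pi}}\,\mathrm{d}x$, with respect to which the $h_k$ are orthonormal. Here $\beta$ is the inverse temperature, $V$ the monomer energy and $\alpha$ the parameter of the dimer potential $W(z)=\alpha|z|$, $z\in\mathbb{Z}$. *)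

theory Defs
  imports "HOL-Probability.Probability"
begin

primrec markov_chain ::
    "real \<Rightarrow> ('a \<Rightarrow> real) \<Rightarrow> (nat \<Rightarrow> 'a \<Rightarrow> real) \<Rightarrow> nat \<Rightarrow> 'a \<Rightarrow> real" where
  "markov_chain \<rho> \<sigma>\<^sub>0 w 0 \<omega> = \<sigma>\<^sub>0 \<omega>"
| "markov_chain \<rho> \<sigma>\<^sub>0 w (Suc k) \<omega> =
     \<rho> * markov_chain \<rho> \<sigma>\<^sub>0 w k \<omega> + sqrt (1 - \<rho>\<^sup>2) * w k \<omega>"

definition aux_seq ::
    "real \<Rightarrow> real \<Rightarrow> ('a \<Rightarrow> real) \<Rightarrow> (nat \<Rightarrow> 'a \<Rightarrow> real) \<Rightarrow> nat \<Rightarrow> 'a \<Rightarrow> real" where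
  "aux_seq \<mu> \<rho> \<sigma>\<^sub>0 w k \<omega> = \<mu> + markov_chain \<rho> \<sigma>\<^sub>0 w k \<omega>"

(* Independence of sigma_0, w_0, w_1, ... as one family: index 0 is sigma_0, index Suc k is w_k. *)
definition indep_std_normals ::
    "'a measure \<Rightarrow> ('a \<Rightarrow> real) \<Rightarrow> (nat \<Rightarrow> 'a \<Rightarrow> real) \<Rightarrow> bool" where
  "indep_std_normals M \<sigma>\<^sub>0 w \<longleftrightarrow>
     prob_space.indep_vars M (\<lambda>_. borel) (case_nat \<sigma>\<^sub>0 w) UNIV \<and>
     distributed M lborel \<sigma>\<^sub>0 std_normal_density \<and>
     (\<forall>k. distributed M lborel (w k) std_normal_density)"

(* "q(X) = E(Y | X)": q is a Borel function whose composition with X is a version of the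
   conditional expectation of Y with respect to the sigma-algebra generated by X.  This determines
   q up to null sets of the law of X. *)
definition is_cond_exp_fun ::
    "'a measure \<Rightarrow> ('a \<Rightarrow> real) \<Rightarrow> ('a \<Rightarrow> real) \<Rightarrow> (real \<Rightarrow> real) \<Rightarrow> bool" where
  "is_cond_exp_fun M Y X q \<longleftrightarrow>
     q \<in> borel_measurable borel \<and>
     (AE \<omega> in M. q (X \<omega>) = real_cond_exp M (vimage_algebra (space M) X borel) Y \<omega>)"

definition hermite :: "nat \<Rightarrow> real \<Rightarrow> real" where
  "hermite k x = (-1) ^ k * exp (x\<^sup>2 / 2) * (deriv ^^ k) (\<lambda>y. exp (- y\<^sup>2 / 2)) x"

definition hermite_normalized :: "nat \<Rightarrow> real \<Rightarrow> real" where
  "hermite_normalized k x = hermite k x / sqrt (fact k)"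

definition gauss_inner :: "(real \<Rightarrow> real) \<Rightarrow> (real \<Rightarrow> real) \<Rightarrow> real" where
  "gauss_inner f g = (LINT x|lborel. f x * g x * (exp (- x\<^sup>2 / 2) / sqrt (2 * pi)))"

(* Since Q enters only through integrals against a Gaussian density, T_poly Q does not depend on
   the version of the conditional expectations Q N, the polynomial one being a particular choice. *)
definition T_poly :: "(nat \<Rightarrow> real \<Rightarrow> real) \<Rightarrow> nat \<Rightarrow> real \<Rightarrow> real" where
  "T_poly Q N t =
     (\<Sum>k=0..N. gauss_inner (Q N) (hermite_normalized k) * (t ^ k / sqrt (fact k)))"

end

theory Submission imports Defs "HOL-Computational_Algebra.Formal_Power_Series" begin

text \<open>
  The recurrence becomes transparent once everything is written in the Hermite basis. Identify a
  polynomial \<open>c = \<Sum>\<^sub>n c\<^sub>n t\<^sup>n\<close> with its Hermite expansion \<open>\<Sum>\<^sub>n c\<^sub>n H\<^sub>n\<close>. Three facts translate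
  the operations of the chain into operations on \<open>c\<close>:

  \<^item> one step of the chain, \<open>f \<mapsto> E f(\<rho> x + \<gamma> Z)\<close>, maps \<open>H\<^sub>n\<close> to \<open>\<rho>\<^sup>n H\<^sub>n\<close> (Mehler), that is, it
    replaces \<open>c(t)\<close> by \<open>c(\<rho> t)\<close>;
  \<^item> multiplication by \<open>x\<close> maps \<open>H\<^sub>n\<close> to \<open>H\<^sub>n\<^sub>+\<^sub>1 + n H\<^sub>n\<^sub>-\<^sub>1\<close>, that is, it replaces \<open>c\<close> by
    \<open>t c + c'\<close>;
  \<^item> \<open>e\<^bsup>-t\<^sup>2/2\<^esup> E (H\<^sub>n(X) e\<^bsup>t X\<^esup>) = t\<^sup>n\<close> and \<open>\<langle>H\<^sub>m, H\<^sub>n\<rangle> = n!\<close> if \<open>m = n\<close> and \<open>0\<close> otherwise, so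
    that both descriptions of \<open>T\<^sub>N\<close> recover \<open>c\<close> from the Hermite expansion of \<open>Q\<^sub>N\<close>.

  Since \<open>Q\<^sub>N\<^sub>+\<^sub>1(x) = (\<mu> + x) E Q\<^sub>N(\<rho> x + \<gamma> Z)\<close>, the first two facts say that \<open>T\<^sub>N\<^sub>+\<^sub>1\<close> arises from
  \<open>T\<^sub>N\<close> by \<open>c(t) \<mapsto> (\<mu> + t) c(\<rho> t) + d/dt c(\<rho> t)\<close>, called \<open>transfer\<close> below, which is the
  claimed recurrence (\<open>hermite_expansion_transfer\<close>, \<open>poly_transfer\<close>).

  The probabilistic part identifies the conditional expectation almost everywhere
  (\<open>cond_exp_fun_AE_hermite_expansion\<close>). To this end the noise variables in
  \<open>E (1\<^sub>B(\<sigma>\<^sub>0) \<xi>\<^sub>0 \<dots> \<xi>\<^sub>N\<^sub>-\<^sub>1)\<close> are integrated out one at a time, starting with the most recent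
  one; each removal, together with the factor \<open>\<xi>\<^sub>k\<close> of the preceding time, applies \<open>transfer\<close> once (\<open>expectation_chain_hermite_expansion\<close>).
\<close>

section \<open>Hermite polynomials\<close>

primrec hermite_poly :: "nat \<Rightarrow> real poly" where
  "hermite_poly 0 = 1"
| "hermite_poly (Suc k) = pCons 0 (hermite_poly k) - pderiv (hermite_poly k)"

lemma pderiv_hermite_poly_Suc:
  "pderiv (hermite_poly (Suc k)) = smult (real (Suc k)) (hermite_poly k)"
proof (induction k)
  case (Suc k)
  have "pderiv (hermite_poly (Suc (Suc k))) =
      hermite_poly (Suc k) + (pCons 0 (pderiv (hermite_poly (Suc k))) - pderiv (pderiv (hermite_poly (Suc k))))"
    by (simp add: pderiv_pCons pderiv_diff)
  also have "\<dots> = hermite_poly (Suc k) + smult (real (Suc k)) (hermite_poly (Suc k))"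
    by (simp add: Suc.IH pderiv_smult smult_diff_right del: hermite_poly.simps(2) of_nat_Suc)
       (simp add: smult_diff_right)
  also have "\<dots> = smult (real (Suc (Suc k))) (hermite_poly (Suc k))"
    using smult_add_left[of 1 "real (Suc k)" "hermite_poly (Suc k)"]
    by (simp del: hermite_poly.simps)
  finally show ?case .
qed (simp add: pderiv_pCons)

lemma hermite_poly_rec:
  "hermite_poly (Suc (Suc k)) = pCons 0 (hermite_poly (Suc k)) - smult (real (Suc k)) (hermite_poly k)"
  using pderiv_hermite_poly_Suc[of k] by simp

text \<open>Differentiating \<open>p(y) e\<^bsup>-y\<^sup>2/2\<^esup>\<close> turns \<open>p\<close> into \<open>p' - y p\<close>, which is the defining recursion of
  \<open>hermite_poly\<close> up to sign.\<close>
lemma higher_deriv_gaussian: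
  "(deriv ^^ k) (\<lambda>y::real. exp (- y\<^sup>2 / 2)) =
     (\<lambda>y. (-1) ^ k * poly (hermite_poly k) y * exp (- y\<^sup>2 / 2))"
proof (induction k)
  case (Suc k)
  have "deriv (\<lambda>y. (-1) ^ k * poly (hermite_poly k) y * exp (- y\<^sup>2 / 2)) x =
      (-1) ^ Suc k * poly (hermite_poly (Suc k)) x * exp (- x\<^sup>2 / 2)" for x :: real
    by (rule DERIV_imp_deriv) (auto intro!: derivative_eq_intros poly_DERIV simp: algebra_simps)
  then show ?case by (simp only: funpow.simps o_apply Suc.IH)
qed simp

lemma hermite_eq_poly: "hermite k x = poly (hermite_poly k) x"
proof -
  have "hermite k x = ((-1) ^ k * (-1) ^ k) * (exp (x\<^sup>2 / 2) * exp (- x\<^sup>2 / 2)) * poly (hermite_poly k) x"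
    unfolding hermite_def higher_deriv_gaussian by (simp only: mult_ac)
  then show ?thesis by (simp add: mult_exp_exp flip: power_mult_distrib)
qed

section \<open>Gaussian means of polynomials\<close>

definition gauss_mean :: "real poly \<Rightarrow> real" where
  "gauss_mean p = (LINT x|lborel. std_normal_density x * poly p x)"

text \<open>The monomial factor makes the induction on \<open>p\<close> go through: \<open>x\<^sup>n (a + x p)\<close> splits into
  terms of the same form.\<close>
lemma integrable_gauss_poly: "integrable lborel (\<lambda>x. std_normal_density x * (x ^ n * poly p x))"
proof (induction p arbitrary: n)
  case (pCons a p)
  have "integrable lborel (\<lambda>x. a * (std_normal_density x * x ^ n) + std_normal_density x * (x ^ Suc n * poly p x))"
    by (intro Bochner_Integration.integrable_add integrable_mult_right integrable_std_normal_moment pCons.IH)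
  then show ?case by (simp add: algebra_simps)
qed simp

lemma integrable_gauss_poly': "integrable lborel (\<lambda>x. std_normal_density x * poly p x)"
  using integrable_gauss_poly[of 0 p] by simp

lemma gauss_mean_add: "gauss_mean (p + q) = gauss_mean p + gauss_mean q"
  by (simp add: gauss_mean_def distrib_left integrable_gauss_poly')

lemma gauss_mean_smult: "gauss_mean (smult a p) = a * gauss_mean p"
  by (simp add: gauss_mean_def mult.left_commute)

lemma gauss_mean_diff: "gauss_mean (p - q) = gauss_mean p - gauss_mean q"
  using gauss_mean_add[of p "smult (-1) q"] gauss_mean_smult[of "-1" q] by simp

lemma gauss_mean_sum: "gauss_mean (\<Sum>i\<in>A. f i) = (\<Sum>i\<in>A. gauss_mean (f i))"
  by (induction A rule: infinite_finite_induct) (simp_all add: gauss_mean_add gauss_mean_def[of 0])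

lemma gauss_mean_1: "gauss_mean 1 = 1"
  using integral_std_normal_moment_even[of 0] by (simp add: gauss_mean_def)

lemma gauss_mean_monom_Suc_Suc: "gauss_mean (monom 1 (Suc (Suc n))) = real (Suc n) * gauss_mean (monom 1 n)"
proof (cases "even n")
  case True
  then obtain k where n: "n = 2 * k" by blast
  have "gauss_mean (monom 1 (2 * Suc k)) = fact (2 * Suc k) / (2 ^ Suc k * fact (Suc k))"
    unfolding gauss_mean_def poly_monom mult_1 by (rule integral_std_normal_moment_even)
  also have "\<dots> = real (Suc (2 * k)) * (fact (2 * k) / (2 ^ k * fact k))"
    by (simp add: divide_simps)
  also have "fact (2 * k) / (2 ^ k * fact k) = gauss_mean (monom 1 (2 * k))"
    unfolding gauss_mean_def poly_monom mult_1 by (rule integral_std_normal_moment_even[symmetric])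
  finally show ?thesis by (simp add: n)
next
  case False
  then obtain k where n: "n = 2 * k + 1" by (auto elim: oddE)
  have *: "gauss_mean (monom 1 (2 * j + 1)) = 0" for j
    unfolding gauss_mean_def poly_monom mult_1 by (rule integral_std_normal_moment_odd)
  show ?thesis using *[of k] *[of "Suc k"] by (simp add: n)
qed

text \<open>Stein's identity \<open>E (X p(X)) = E p'(X)\<close>, the source of all Gaussian computations below. By
  linearity it is a statement about monomials, where it is the recursion of the moments.\<close>
lemma gauss_mean_stein: "gauss_mean (pCons 0 p) = gauss_mean (pderiv p)"
proof -
  have "gauss_mean (pCons 0 (monom 1 n * p)) = gauss_mean (pderiv (monom 1 n * p))" for n
  proof (induction p arbitrary: n)
    case (pCons a p)
    have split: "monom 1 n * pCons a p = smult a (monom 1 n) + monom 1 (Suc n) * p"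
      by (simp add: monom_Suc)
    have "gauss_mean (pCons 0 (monom 1 n)) = gauss_mean (pderiv (monom 1 n))"
    proof (cases n)
      case 0
      have "gauss_mean (monom 1 (2 * 0 + 1)) = 0"
        unfolding gauss_mean_def poly_monom mult_1 by (rule integral_std_normal_moment_odd)
      then show ?thesis by (simp add: 0 monom_Suc monom_0 gauss_mean_def[of 0])
    next
      case (Suc m)
      then show ?thesis
        using gauss_mean_monom_Suc_Suc[of m] gauss_mean_smult[of "real (Suc m)" "monom 1 m"]
        by (simp add: pderiv_monom smult_monom flip: monom_Suc)
    qed
    moreover have "pCons 0 (smult a (monom 1 n) + monom 1 (Suc n) * p) =
        smult a (pCons 0 (monom 1 n)) + pCons 0 (monom 1 (Suc n) * p)"
      by simp
    ultimately show ?case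
      unfolding split by (simp only: pderiv_add pderiv_smult gauss_mean_add gauss_mean_smult pCons.IH)
  qed simp
  from this[of 0] show ?thesis by simp
qed

text \<open>Stein's identity makes \<open>p \<mapsto> X p - p'\<close>, which raises the Hermite index, adjoint to
  differentiation.\<close>
lemma gauss_mean_hermite_mult:
  "gauss_mean (hermite_poly (Suc k) * p) = gauss_mean (hermite_poly k * pderiv p)"
proof -
  have "hermite_poly (Suc k) * p = pCons 0 (hermite_poly k * p) - p * pderiv (hermite_poly k)"
    by (simp add: algebra_simps)
  also have "gauss_mean \<dots> = gauss_mean (hermite_poly k * pderiv p)"
    by (simp add: gauss_mean_diff gauss_mean_stein pderiv_mult gauss_mean_add)
  finally show ?thesis .
qed

lemma gauss_mean_hermite_orthogonal:
  "gauss_mean (hermite_poly j * hermite_poly k) = (if j = k then fact k else 0)"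
proof (induction j arbitrary: k)
  case 0
  show ?case
  proof (cases k)
    case (Suc m)
    then show ?thesis using gauss_mean_hermite_mult[of m 1] by (simp add: gauss_mean_def[of 0])
  qed (simp add: gauss_mean_1)
next
  case (Suc j)
  show ?case
  proof (cases k)
    case 0
    then show ?thesis using gauss_mean_hermite_mult[of j 1] by (simp add: gauss_mean_def[of 0])
  next
    case (Suc m)
    then show ?thesis
      by (simp add: gauss_mean_hermite_mult pderiv_hermite_poly_Suc gauss_mean_smult Suc.IH
          del: hermite_poly.simps)
  qed
qed

lemma gauss_mean_hermite: "gauss_mean (hermite_poly n) = (if n = 0 then 1 else 0)"
  using gauss_mean_hermite_orthogonal[of n 0] by auto

text \<open>The extra factor \<open>t\<close> in each step is the shift: in \<open>E ((X + t) q(X) - q'(X))\<close> Stein's identity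
  cancels all but \<open>t E q(X)\<close>.\<close>
lemma gauss_mean_hermite_shift: "gauss_mean (pcompose (hermite_poly k) [:t, 1:]) = t ^ k"
proof (induction k)
  case (Suc k)
  let ?q = "pcompose (hermite_poly k) [:t, 1:]"
  have "pcompose (hermite_poly (Suc k)) [:t, 1:] = smult t ?q + pCons 0 ?q - pderiv ?q"
    by (simp add: pcompose_diff pcompose_pCons pderiv_pcompose pderiv_pCons)
  then show ?case
    by (simp add: gauss_mean_diff gauss_mean_add gauss_mean_smult gauss_mean_stein Suc.IH
        del: hermite_poly.simps)
qed (simp add: gauss_mean_1 pcompose_1)

text \<open>Completing the square turns the exponential weight into a translation of the Gaussian.\<close>
lemma gauss_laplace_poly:
  "(LINT x|lborel. std_normal_density x * (poly p x * exp (t * x))) =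
     exp (t\<^sup>2 / 2) * gauss_mean (pcompose p [:t, 1:])"
proof -
  have "(LINT x|lborel. std_normal_density x * (poly p x * exp (t * x))) =
      (LINT x|lborel. std_normal_density (t + x) * (poly p (t + x) * exp (t * (t + x))))"
    using lborel_integral_real_affine[of 1 "\<lambda>x. std_normal_density x * (poly p x * exp (t * x))" t]
    by simp
  also have "\<dots> = (LINT x|lborel. exp (t\<^sup>2 / 2) * (std_normal_density x * poly (pcompose p [:t, 1:]) x))"
  proof (rule Bochner_Integration.integral_cong[OF refl])
    fix x :: real
    have "- (t + x)\<^sup>2 / 2 + t * (t + x) = t\<^sup>2 / 2 + - x\<^sup>2 / 2"
      by (simp add: power2_eq_square field_simps)
    then have "exp (- (t + x)\<^sup>2 / 2) * exp (t * (t + x)) = exp (t\<^sup>2 / 2) * exp (- x\<^sup>2 / 2)"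
      by (simp only: mult_exp_exp)
    then show "std_normal_density (t + x) * (poly p (t + x) * exp (t * (t + x))) =
        exp (t\<^sup>2 / 2) * (std_normal_density x * poly (pcompose p [:t, 1:]) x)"
      by (simp add: std_normal_density_def poly_pcompose)
  qed
  finally show ?thesis by (simp add: gauss_mean_def)
qed

section \<open>The addition formula\<close>

text \<open>The generating function \<open>\<Sum>\<^sub>n H\<^sub>n(x) X\<^sup>n / n!\<close> solves \<open>F' = (x - X) F\<close>, and the equation
  determines the coefficients because it is the three-term recurrence of the Hermite polynomials.\<close>
lemma fps_nth_hermite_ode:
  assumes "fps_deriv F = (fps_const x - fps_X) * F" and "fps_nth F 0 = 1"
  shows "fps_nth F n = poly (hermite_poly n) x / fact n"
proof -
  have rec: "real (Suc n) * fps_nth F (Suc n) = x * fps_nth F n - (if n = 0 then 0 else fps_nth F (n - 1))" for n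
    using arg_cong[OF assms(1), of "\<lambda>G. fps_nth G n"] by (simp add: left_diff_distrib)
  have "fps_nth F n = poly (hermite_poly n) x / fact n
      \<and> fps_nth F (Suc n) = poly (hermite_poly (Suc n)) x / fact (Suc n)"
  proof (induction n)
    case 0
    show ?case using rec[of 0] assms(2) by simp
  next
    case (Suc n)
    have "real (Suc (Suc n)) * fps_nth F (Suc (Suc n)) =
        poly (hermite_poly (Suc (Suc n))) x / fact (Suc n)"
      using rec[of "Suc n"] Suc.IH
      by (simp add: hermite_poly_rec diff_divide_distrib del: hermite_poly.simps of_nat_Suc)
    moreover have "fact (Suc (Suc n)) = real (Suc (Suc n)) * fact (Suc n)" by simp
    ultimately have "fps_nth F (Suc (Suc n)) = poly (hermite_poly (Suc (Suc n))) x / fact (Suc (Suc n))"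
      by (simp add: nonzero_eq_divide_eq mult_ac del: hermite_poly.simps fact_Suc of_nat_Suc)
    then show ?case using Suc.IH by blast
  qed
  then show ?thesis by blast
qed

definition hermite_fps :: "real \<Rightarrow> real \<Rightarrow> real fps" where
  "hermite_fps a x = Abs_fps (\<lambda>n. a ^ n * poly (hermite_poly n) x / fact n)"

lemma fps_deriv_hermite_fps:
  "fps_deriv (hermite_fps a x) = (fps_const (a * x) - fps_const (a\<^sup>2) * fps_X) * hermite_fps a x"
proof (rule fps_ext)
  fix n
  show "fps_nth (fps_deriv (hermite_fps a x)) n =
    fps_nth ((fps_const (a * x) - fps_const (a\<^sup>2) * fps_X) * hermite_fps a x) n"
  proof (cases n)
    case 0
    then show ?thesis by (simp add: hermite_fps_def left_diff_distrib mult.assoc)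
  next
    case (Suc m)
    have "fact (Suc (Suc m)) = real (Suc (Suc m)) * fact (Suc m)" "fact (Suc m) = real (Suc m) * fact m"
      by simp_all
    then show ?thesis
      by (simp add: Suc hermite_fps_def left_diff_distrib mult.assoc hermite_poly_rec
          del: hermite_poly.simps(2) fact_Suc of_nat_Suc)
         (simp add: field_simps power2_eq_square del: of_nat_Suc)
  qed
qed

text \<open>The logarithmic derivatives \<open>a x - a\<^sup>2 X\<close> and \<open>b z - b\<^sup>2 X\<close> of the two scaled generating
  functions add up to \<open>(a x + b z) - X\<close>, so their product is the generating function at
  \<open>a x + b z\<close>.\<close>
lemma hermite_poly_addition:
  assumes "a\<^sup>2 + b\<^sup>2 = 1"
  shows "poly (hermite_poly n) (a * x + b * z) = fact n *
     (\<Sum>i\<le>n. (a ^ i * poly (hermite_poly i) x / fact i) * (b ^ (n - i) * poly (hermite_poly (n - i)) z / fact (n - i)))"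
proof -
  let ?F = "hermite_fps a x * hermite_fps b z"
  have "fps_deriv ?F = (fps_const (a * x + b * z) - fps_const (a\<^sup>2 + b\<^sup>2) * fps_X) * ?F"
    by (simp add: fps_deriv_hermite_fps algebra_simps flip: fps_const_add)
  then have "fps_deriv ?F = (fps_const (a * x + b * z) - fps_X) * ?F"
    by (simp add: assms)
  moreover have "fps_nth ?F 0 = 1" by (simp add: hermite_fps_def)
  ultimately have "fps_nth ?F n = poly (hermite_poly n) (a * x + b * z) / fact n"
    by (rule fps_nth_hermite_ode)
  then show ?thesis
    by (simp add: fps_mult_nth hermite_fps_def atMost_atLeast0 field_simps)
qed

section \<open>Hermite expansions\<close>

lemma smult_sum_right: "smult a (\<Sum>i\<in>A. f i) = (\<Sum>i\<in>A. smult a (f i))"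
  by (induction A rule: infinite_finite_induct) (simp_all add: smult_add_right)

lemma pderiv_sum: "pderiv (\<Sum>i\<in>A. f i) = (\<Sum>i\<in>A. pderiv (f i))"
  by (induction A rule: infinite_finite_induct) (simp_all add: pderiv_add)

definition hermite_expansion :: "real poly \<Rightarrow> real poly" where
  "hermite_expansion c = (\<Sum>n\<le>degree c. smult (coeff c n) (hermite_poly n))"

lemma hermite_expansion_eq_sum:
  assumes "degree c \<le> m"
  shows "hermite_expansion c = (\<Sum>n\<le>m. smult (coeff c n) (hermite_poly n))"
  unfolding hermite_expansion_def using assms
  by (intro sum.mono_neutral_left) (auto simp: coeff_eq_0)

lemma hermite_expansion_add: "hermite_expansion (c + d) = hermite_expansion c + hermite_expansion d"
proof -
  let ?m = "max (degree c) (degree d)"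
  have "degree (c + d) \<le> ?m" by (simp add: degree_add_le)
  then show ?thesis
    by (simp add: hermite_expansion_eq_sum[of _ ?m] smult_add_left sum.distrib)
qed

lemma hermite_expansion_smult: "hermite_expansion (smult a c) = smult a (hermite_expansion c)"
  by (simp add: hermite_expansion_eq_sum[OF degree_smult_le] hermite_expansion_def smult_sum_right)

text \<open>Multiplying the coefficient polynomial by \<open>t\<close> shifts all Hermite indices up by one. Read together
  with \<open>pderiv_hermite_expansion\<close> this says that multiplication by \<open>x\<close> acts on the coefficient
  polynomial as \<open>c \<mapsto> t c + c'\<close>.\<close>
lemma hermite_expansion_pCons_0:
  "hermite_expansion (pCons 0 c) = pCons 0 (hermite_expansion c) - pderiv (hermite_expansion c)"
proof -
  have "hermite_expansion (pCons 0 c) = (\<Sum>n\<le>Suc (degree c). smult (coeff (pCons 0 c) n) (hermite_poly n))"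
    by (rule hermite_expansion_eq_sum) (rule degree_pCons_le)
  also have "\<dots> = (\<Sum>n\<le>degree c. smult (coeff c n) (hermite_poly (Suc n)))"
    by (simp add: sum.atMost_Suc_shift del: sum.atMost_Suc hermite_poly.simps)
  also have "\<dots> = [:0, 1:] * hermite_expansion c - pderiv (hermite_expansion c)"
    by (simp add: hermite_expansion_def pderiv_sum sum_distrib_left sum_subtractf[symmetric]
        pderiv_smult smult_diff_right)
  finally show ?thesis by simp
qed

lemma pderiv_hermite_expansion: "pderiv (hermite_expansion c) = hermite_expansion (pderiv c)"
proof -
  have "pderiv (hermite_expansion c) = (\<Sum>n\<le>Suc (degree c). smult (coeff c n) (pderiv (hermite_poly n)))"
    by (simp add: hermite_expansion_eq_sum[of c "Suc (degree c)"] pderiv_sum pderiv_smult del: sum.atMost_Suc)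
  also have "\<dots> = (\<Sum>n\<le>degree c. smult (coeff (pderiv c) n) (hermite_poly n))"
    by (simp add: sum.atMost_Suc_shift pderiv_hermite_poly_Suc coeff_pderiv mult.commute
        del: sum.atMost_Suc hermite_poly.simps of_nat_Suc) (simp add: one_pCons)
  also have "\<dots> = hermite_expansion (pderiv c)"
    by (rule hermite_expansion_eq_sum[symmetric]) (simp add: degree_pderiv)
  finally show ?thesis .
qed

lemma gauss_mean_hermite_expansion_mult:
  "gauss_mean (hermite_expansion c * hermite_poly k) = fact k * coeff c k"
proof -
  have "gauss_mean (hermite_expansion c * hermite_poly k) =
      (\<Sum>n\<le>max k (degree c). coeff c n * gauss_mean (hermite_poly n * hermite_poly k))"
    by (simp add: hermite_expansion_eq_sum[of c "max k (degree c)"] sum_distrib_right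
        gauss_mean_sum gauss_mean_smult)
  also have "\<dots> = fact k * coeff c k"
    by (simp add: gauss_mean_hermite_orthogonal if_distrib cong: if_cong)
  finally show ?thesis .
qed

text \<open>Together with \<open>gauss_laplace_poly\<close>: the normalised Laplace transform of a Hermite expansion is
  the coefficient polynomial itself.\<close>
lemma gauss_mean_hermite_expansion_shift:
  "gauss_mean (pcompose (hermite_expansion c) [:t, 1:]) = poly c t"
  by (simp add: hermite_expansion_def pcompose_sum pcompose_smult gauss_mean_sum gauss_mean_smult
      gauss_mean_hermite_shift poly_altdef)

definition dilate :: "real \<Rightarrow> real poly \<Rightarrow> real poly" where
  "dilate a c = pcompose c [:0, a:]"

text \<open>The action of \<open>f(x) \<mapsto> (\<mu> + x) E f(\<rho> x + \<gamma> Z)\<close> on the coefficient polynomials of Hermite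
  expansions.\<close>
definition transfer :: "real \<Rightarrow> real \<Rightarrow> real poly \<Rightarrow> real poly" where
  "transfer \<mu> \<rho> c = [:\<mu>, 1:] * dilate \<rho> c + pderiv (dilate \<rho> c)"

lemma hermite_expansion_transfer:
  "hermite_expansion (transfer \<mu> \<rho> c) = [:\<mu>, 1:] * hermite_expansion (dilate \<rho> c)"
  by (simp add: transfer_def hermite_expansion_add hermite_expansion_smult hermite_expansion_pCons_0
      pderiv_hermite_expansion)

lemma degree_dilate_le: "degree (dilate a c) \<le> degree c"
  unfolding dilate_def using degree_pcompose_le[of c "[:0, a:]"]
  by (simp split: if_splits)

lemma degree_transfer: "degree (transfer \<mu> \<rho> c) \<le> Suc (degree c)"
proof -
  have "degree ([:\<mu>, 1:] * dilate \<rho> c) \<le> 1 + degree c"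
    using degree_mult_le[of "[:\<mu>, 1:]" "dilate \<rho> c"] degree_dilate_le[of \<rho> c] by simp
  then show ?thesis
    unfolding transfer_def using degree_dilate_le[of \<rho> c] by (intro degree_add_le) (auto simp: degree_pderiv)
qed

lemma poly_transfer:
  "poly (transfer \<mu> \<rho> c) t = (\<mu> + t) * poly c (\<rho> * t) + \<rho> * poly (pderiv c) (\<rho> * t)"
  by (simp add: transfer_def dilate_def pderiv_pcompose pderiv_pCons poly_pcompose algebra_simps)

lemma degree_transfer_iterate: "degree ((transfer \<mu> \<rho> ^^ N) 1) \<le> N"
proof (induction N)
  case (Suc N)
  then show ?case using degree_transfer[of \<mu> \<rho> "(transfer \<mu> \<rho> ^^ N) 1"] by simp
qed simp

section \<open>Random variables with all moments\<close>

text \<open>All integrands below are polynomials in Gaussian variables times an indicator. They are integrable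
  because the functions with moments of every order form an algebra.\<close>
definition all_moments :: "'a measure \<Rightarrow> ('a \<Rightarrow> real) \<Rightarrow> bool" where
  "all_moments M f \<longleftrightarrow> f \<in> borel_measurable M \<and> (\<forall>n::nat. integrable M (\<lambda>\<omega>. \<bar>f \<omega>\<bar> ^ n))"

lemma all_moments_measurable: "all_moments M f \<Longrightarrow> f \<in> borel_measurable M"
  by (simp add: all_moments_def)

lemma all_moments_integrable:
  assumes "all_moments M f"
  shows "integrable M f"
proof -
  have "integrable M (\<lambda>\<omega>. \<bar>f \<omega>\<bar> ^ 1)" using assms unfolding all_moments_def by blast
  then show ?thesis using integrable_abs_iff[OF all_moments_measurable[OF assms]] by simp
qed

lemma all_moments_mult:
  assumes "all_moments M f" and "all_moments M g"
  shows "all_moments M (\<lambda>\<omega>. f \<omega> * g \<omega>)"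
  unfolding all_moments_def
proof (intro conjI allI)
  have [measurable]: "f \<in> borel_measurable M" "g \<in> borel_measurable M"
    using assms by (simp_all add: all_moments_def)
  show "(\<lambda>\<omega>. f \<omega> * g \<omega>) \<in> borel_measurable M" by measurable
  fix n :: nat
  have "integrable M (\<lambda>\<omega>. \<bar>f \<omega>\<bar> ^ (2 * n) + \<bar>g \<omega>\<bar> ^ (2 * n))"
    using assms by (simp add: all_moments_def)
  then show "integrable M (\<lambda>\<omega>. \<bar>f \<omega> * g \<omega>\<bar> ^ n)"
  proof (rule Bochner_Integration.integrable_bound)
    show "AE \<omega> in M. norm (\<bar>f \<omega> * g \<omega>\<bar> ^ n) \<le> norm (\<bar>f \<omega>\<bar> ^ (2 * n) + \<bar>g \<omega>\<bar> ^ (2 * n))"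
    proof (rule AE_I2)
      fix \<omega>
      have "2 * (\<bar>f \<omega>\<bar> ^ n * \<bar>g \<omega>\<bar> ^ n) \<le> (\<bar>f \<omega>\<bar> ^ n)\<^sup>2 + (\<bar>g \<omega>\<bar> ^ n)\<^sup>2"
        using sum_squares_bound[of "\<bar>f \<omega>\<bar> ^ n" "\<bar>g \<omega>\<bar> ^ n"] by (simp add: mult.assoc)
      moreover have "0 \<le> \<bar>f \<omega>\<bar> ^ n * \<bar>g \<omega>\<bar> ^ n" by simp
      ultimately have "\<bar>f \<omega>\<bar> ^ n * \<bar>g \<omega>\<bar> ^ n \<le> (\<bar>f \<omega>\<bar> ^ n)\<^sup>2 + (\<bar>g \<omega>\<bar> ^ n)\<^sup>2" by linarith
      then show "norm (\<bar>f \<omega> * g \<omega>\<bar> ^ n) \<le> norm (\<bar>f \<omega>\<bar> ^ (2 * n) + \<bar>g \<omega>\<bar> ^ (2 * n))"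
        by (simp add: abs_mult power_mult_distrib power_even_eq)
    qed
  qed measurable
qed

lemma all_moments_add:
  assumes "all_moments M f" and "all_moments M g"
  shows "all_moments M (\<lambda>\<omega>. f \<omega> + g \<omega>)"
  unfolding all_moments_def
proof (intro conjI allI)
  have [measurable]: "f \<in> borel_measurable M" "g \<in> borel_measurable M"
    using assms by (simp_all add: all_moments_def)
  show "(\<lambda>\<omega>. f \<omega> + g \<omega>) \<in> borel_measurable M" by measurable
  fix n :: nat
  have "integrable M (\<lambda>\<omega>. 2 ^ n * (\<bar>f \<omega>\<bar> ^ n + \<bar>g \<omega>\<bar> ^ n))"
    using assms by (simp add: all_moments_def)
  then show "integrable M (\<lambda>\<omega>. \<bar>f \<omega> + g \<omega>\<bar> ^ n)"
  proof (rule Bochner_Integration.integrable_bound)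
    show "AE \<omega> in M. norm (\<bar>f \<omega> + g \<omega>\<bar> ^ n) \<le> norm (2 ^ n * (\<bar>f \<omega>\<bar> ^ n + \<bar>g \<omega>\<bar> ^ n))"
    proof (rule AE_I2)
      fix \<omega>
      let ?m = "max \<bar>f \<omega>\<bar> \<bar>g \<omega>\<bar>"
      have "\<bar>f \<omega> + g \<omega>\<bar> ^ n \<le> (2 * ?m) ^ n" by (intro power_mono) auto
      also have "\<dots> = 2 ^ n * ?m ^ n" by (simp add: power_mult_distrib)
      also have "?m ^ n \<le> \<bar>f \<omega>\<bar> ^ n + \<bar>g \<omega>\<bar> ^ n" by (simp add: max_def)
      finally show "norm (\<bar>f \<omega> + g \<omega>\<bar> ^ n) \<le> norm (2 ^ n * (\<bar>f \<omega>\<bar> ^ n + \<bar>g \<omega>\<bar> ^ n))" by simp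
    qed
  qed measurable
qed

context prob_space
begin

lemma all_moments_bounded:
  assumes [measurable]: "f \<in> borel_measurable M" and "\<And>\<omega>. \<bar>f \<omega>\<bar> \<le> b"
  shows "all_moments M f"
  unfolding all_moments_def
proof (intro conjI allI)
  fix n :: nat
  have "\<bar>f \<omega>\<bar> ^ n \<le> b ^ n" for \<omega> using assms(2) by (intro power_mono) auto
  then show "integrable M (\<lambda>\<omega>. \<bar>f \<omega>\<bar> ^ n)" by (intro integrable_const_bound[where B="b ^ n"]) auto
qed measurable

lemma all_moments_const: "all_moments M (\<lambda>_. c)"
  by (rule all_moments_bounded[of _ "\<bar>c\<bar>"]) auto

lemma all_moments_prod:
  assumes "\<And>k. k \<in> K \<Longrightarrow> all_moments M (f k)"
  shows "all_moments M (\<lambda>\<omega>. \<Prod>k\<in>K. f k \<omega>)"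
  using assms
  by (induction K rule: infinite_finite_induct) (simp_all add: all_moments_mult all_moments_const)

lemma all_moments_poly:
  assumes "all_moments M f"
  shows "all_moments M (\<lambda>\<omega>. poly p (f \<omega>))"
  by (induction p) (simp_all add: assms all_moments_add all_moments_mult all_moments_const)

lemma all_moments_std_normal:
  assumes "distributed M lborel X std_normal_density"
  shows "all_moments M X"
  unfolding all_moments_def
proof (intro conjI allI)
  show "X \<in> borel_measurable M" using distributed_measurable[OF assms] by simp
  fix n :: nat
  show "integrable M (\<lambda>\<omega>. \<bar>X \<omega>\<bar> ^ n)"
    using integrable_std_normal_moment_abs[of n]
    by (subst distributed_integrable[OF assms, symmetric]) auto
qed

section \<open>Adding independent Gaussian noise\<close>

lemma expectation_std_normal_poly:
  assumes "distributed M lborel X std_normal_density"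
  shows "expectation (\<lambda>\<omega>. poly p (X \<omega>)) = gauss_mean p"
  unfolding gauss_mean_def
  by (rule distributed_integral[OF assms, symmetric])
     (auto intro!: borel_measurable_continuous_onI continuous_intros)

text \<open>Mehler's formula in weak form. By the addition formula and independence, the left-hand side is a
  combination of the products \<open>E (U H\<^sub>i(S)) E H\<^sub>n\<^sub>-\<^sub>i(W)\<close>, and the mean of \<open>H\<^sub>j(W)\<close> vanishes unless
  \<open>j = 0\<close>, so only \<open>i = n\<close> survives.\<close>
lemma expectation_hermite_add_noise:
  assumes W: "distributed M lborel W std_normal_density"
    and U: "all_moments M U" and S: "all_moments M S"
    and indep: "\<And>p. indep_var borel (\<lambda>\<omega>. U \<omega> * poly p (S \<omega>)) borel W"
    and ab: "a\<^sup>2 + b\<^sup>2 = 1"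
  shows "expectation (\<lambda>\<omega>. U \<omega> * poly (hermite_poly n) (a * S \<omega> + b * W \<omega>)) =
    a ^ n * expectation (\<lambda>\<omega>. U \<omega> * poly (hermite_poly n) (S \<omega>))"
proof -
  define A where "A i \<omega> = U \<omega> * poly (hermite_poly i) (S \<omega>)" for i \<omega>
  define H where "H j \<omega> = poly (hermite_poly j) (W \<omega>)" for j \<omega>
  define d where "d i = fact n * a ^ i * b ^ (n - i) / (fact i * fact (n - i))" for i
  have A_int: "integrable M (A i)" for i
    unfolding A_def by (intro all_moments_integrable all_moments_mult all_moments_poly U S)
  have H_int: "integrable M (H j)" for j
    unfolding H_def by (intro all_moments_integrable all_moments_poly all_moments_std_normal[OF W])
  have H_mean: "expectation (H j) = (if j = 0 then 1 else 0)" for j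
    using expectation_std_normal_poly[OF W, of "hermite_poly j"] by (simp add: H_def[abs_def] gauss_mean_hermite)
  have AH: "indep_var borel (A i) borel (H j)" for i j
    using indep_var_compose[OF indep, of "\<lambda>x. x" borel "poly (hermite_poly j)" borel "hermite_poly i"]
    by (simp add: o_def A_def[abs_def] H_def[abs_def] borel_measurable_continuous_onI continuous_intros)
  have "expectation (\<lambda>\<omega>. U \<omega> * poly (hermite_poly n) (a * S \<omega> + b * W \<omega>)) =
      expectation (\<lambda>\<omega>. \<Sum>i\<le>n. d i * (A i \<omega> * H (n - i) \<omega>))"
    by (simp add: hermite_poly_addition[OF ab] sum_distrib_left A_def H_def d_def mult_ac divide_simps)
  also have "\<dots> = (\<Sum>i\<le>n. d i * (expectation (A i) * expectation (H (n - i))))"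
    by (simp add: indep_var_integrable[OF AH A_int H_int] indep_var_lebesgue_integral[OF AH A_int H_int])
  also have "\<dots> = (\<Sum>i\<le>n. if i = n then a ^ n * expectation (A n) else 0)"
    by (intro sum.cong refl)
       (auto simp: H_mean d_def)
  finally show ?thesis by (simp add: A_def[abs_def])
qed

lemma expectation_hermite_expansion_add_noise:
  assumes W: "distributed M lborel W std_normal_density"
    and U: "all_moments M U" and S: "all_moments M S"
    and indep: "\<And>p. indep_var borel (\<lambda>\<omega>. U \<omega> * poly p (S \<omega>)) borel W"
    and ab: "a\<^sup>2 + b\<^sup>2 = 1"
  shows "expectation (\<lambda>\<omega>. U \<omega> * poly (hermite_expansion c) (a * S \<omega> + b * W \<omega>)) =
    expectation (\<lambda>\<omega>. U \<omega> * poly (hermite_expansion (dilate a c)) (S \<omega>))"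
proof -
  have Y: "all_moments M (\<lambda>\<omega>. a * S \<omega> + b * W \<omega>)"
    by (intro all_moments_add all_moments_mult all_moments_const S all_moments_std_normal[OF W])
  have deg: "degree (dilate a c) \<le> degree c"
    by (rule degree_dilate_le)
  have int: "integrable M (\<lambda>\<omega>. U \<omega> * poly p (Z \<omega>))" if "all_moments M Z" for p Z
    by (intro all_moments_integrable all_moments_mult all_moments_poly U that)
  have "expectation (\<lambda>\<omega>. U \<omega> * poly (hermite_expansion c) (a * S \<omega> + b * W \<omega>)) =
      expectation (\<lambda>\<omega>. \<Sum>n\<le>degree c. coeff c n * (U \<omega> * poly (hermite_poly n) (a * S \<omega> + b * W \<omega>)))"
    by (simp add: hermite_expansion_def poly_sum sum_distrib_left mult.left_commute)
  also have "\<dots> = (\<Sum>n\<le>degree c. coeff c n * (a ^ n * expectation (\<lambda>\<omega>. U \<omega> * poly (hermite_poly n) (S \<omega>))))"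
    by (simp add: int[OF Y] expectation_hermite_add_noise[OF assms])
  also have "\<dots> = expectation (\<lambda>\<omega>. \<Sum>n\<le>degree c. coeff (dilate a c) n * (U \<omega> * poly (hermite_poly n) (S \<omega>)))"
    by (simp add: int[OF S]) (simp add: dilate_def coeff_pcompose_linear mult_ac)
  also have "\<dots> = expectation (\<lambda>\<omega>. U \<omega> * poly (hermite_expansion (dilate a c)) (S \<omega>))"
    by (simp add: hermite_expansion_eq_sum[OF deg] poly_sum sum_distrib_left mult.left_commute)
  finally show ?thesis .
qed

end

section \<open>The Gaussian chain and its conditional product moments\<close>

text \<open>The chain on the space of sequences (start value followed by the noise). It exhibits \<open>\<sigma>\<^sub>k\<close> as a
  measurable function of the first \<open>k + 1\<close> coordinates, which is what independence from later
  noise requires.\<close>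
abbreviation canonical_chain :: "real \<Rightarrow> nat \<Rightarrow> (nat \<Rightarrow> real) \<Rightarrow> real" where
  "canonical_chain \<rho> \<equiv> markov_chain \<rho> (\<lambda>x. x 0) (\<lambda>k x. x (Suc k))"

lemma measurable_canonical_chain:
  "k \<le> m \<Longrightarrow> canonical_chain \<rho> k \<in> borel_measurable (Pi\<^sub>M {..m} (\<lambda>_. borel))"
proof (induction k)
  case (Suc k)
  then have [measurable]: "canonical_chain \<rho> k \<in> borel_measurable (Pi\<^sub>M {..m} (\<lambda>_. borel))"
    "(\<lambda>x. x (Suc k)) \<in> borel_measurable (Pi\<^sub>M {..m} (\<lambda>_. borel :: real measure))"
    by (simp_all add: measurable_component_singleton)
  have "canonical_chain \<rho> (Suc k) = (\<lambda>x. \<rho> * canonical_chain \<rho> k x + sqrt (1 - \<rho>\<^sup>2) * x (Suc k))"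
    by (rule ext) simp
  then show ?case by simp
next
  case 0
  have "canonical_chain \<rho> 0 = (\<lambda>x. x 0)" by (rule ext) simp
  then show ?case by (simp add: measurable_component_singleton)
qed

lemma canonical_chain_restrict:
  "k \<le> m \<Longrightarrow> canonical_chain \<rho> k (restrict (\<lambda>i. case_nat \<sigma>\<^sub>0 w i \<omega>) {..m}) = markov_chain \<rho> \<sigma>\<^sub>0 w k \<omega>"
  by (induction k) simp_all

locale gaussian_chain = prob_space M for M :: "'a measure" +
  fixes \<sigma>\<^sub>0 :: "'a \<Rightarrow> real" and w :: "nat \<Rightarrow> 'a \<Rightarrow> real" and \<mu> \<rho> :: real
  assumes indep_normals: "indep_std_normals M \<sigma>\<^sub>0 w"
    and rho: "\<rho>\<^sup>2 \<le> 1"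
begin

abbreviation "\<sigma> \<equiv> markov_chain \<rho> \<sigma>\<^sub>0 w"
abbreviation "\<xi> \<equiv> aux_seq \<mu> \<rho> \<sigma>\<^sub>0 w"

lemma sigma0_normal: "distributed M lborel \<sigma>\<^sub>0 std_normal_density"
  and noise_normal: "distributed M lborel (w k) std_normal_density"
  and indep: "indep_vars (\<lambda>_. borel) (case_nat \<sigma>\<^sub>0 w) UNIV"
  using indep_normals by (auto simp: indep_std_normals_def)

lemma measurable_sigma0 [measurable]: "\<sigma>\<^sub>0 \<in> borel_measurable M"
  using distributed_measurable[OF sigma0_normal] by simp

lemma all_moments_chain: "all_moments M (\<sigma> k)"
proof (induction k)
  case 0
  have "\<sigma> 0 = \<sigma>\<^sub>0" by (simp add: fun_eq_iff)
  then show ?case using all_moments_std_normal[OF sigma0_normal] by simp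
next
  case (Suc k)
  have "\<sigma> (Suc k) = (\<lambda>\<omega>. \<rho> * \<sigma> k \<omega> + sqrt (1 - \<rho>\<^sup>2) * w k \<omega>)" by (simp add: fun_eq_iff)
  then show ?case
    using all_moments_std_normal[OF noise_normal[of k]]
    by (simp add: all_moments_add all_moments_mult all_moments_const Suc.IH)
qed

lemma all_moments_aux: "all_moments M (\<xi> k)"
proof -
  have "\<xi> k = (\<lambda>\<omega>. \<mu> + \<sigma> k \<omega>)" by (simp add: aux_seq_def fun_eq_iff)
  then show ?thesis by (simp add: all_moments_add all_moments_const all_moments_chain)
qed

text \<open>The product is a function of \<open>\<sigma>\<^sub>0, w\<^sub>0, \<dots>, w\<^sub>m\<^sub>-\<^sub>1\<close>, the coordinates \<open>0, \<dots>, m\<close> of the independent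
  family, whereas \<open>w\<^sub>m\<close> is coordinate \<open>m + 1\<close>.\<close>
lemma indep_past_noise:
  assumes [measurable]: "B \<in> sets borel"
  shows "indep_var borel (\<lambda>\<omega>. indicator B (\<sigma>\<^sub>0 \<omega>) * (\<Prod>k<Suc m. \<xi> k \<omega>) * poly p (\<sigma> m \<omega>)) borel (w m)"
proof -
  let ?I = "{..m}" and ?X = "\<lambda>\<omega> i. case_nat \<sigma>\<^sub>0 w i \<omega>"
  let ?past = "\<lambda>x. indicator B (x 0) * (\<Prod>k<Suc m. \<mu> + canonical_chain \<rho> k x) * poly p (canonical_chain \<rho> m x)"
  have chain [measurable]: "canonical_chain \<rho> k \<in> borel_measurable (Pi\<^sub>M ?I (\<lambda>_. borel))" if "k \<le> m" for k
    using that by (rule measurable_canonical_chain)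
  have start [measurable]: "(\<lambda>x. x 0) \<in> borel_measurable (Pi\<^sub>M ?I (\<lambda>_. borel :: real measure))"
    by (simp add: measurable_component_singleton)
  have poly_meas [measurable]: "poly p \<in> borel_measurable borel"
    by (intro borel_measurable_continuous_onI continuous_intros)
  have prod: "(\<lambda>x. \<Prod>k<Suc m. \<mu> + canonical_chain \<rho> k x) \<in> borel_measurable (Pi\<^sub>M ?I (\<lambda>_. borel))"
    by (intro borel_measurable_prod borel_measurable_add borel_measurable_const chain) auto
  have "(\<lambda>x. indicator B (x 0) :: real) \<in> borel_measurable (Pi\<^sub>M ?I (\<lambda>_. borel))"
    using start by measurable
  moreover have "(\<lambda>x. poly p (canonical_chain \<rho> m x)) \<in> borel_measurable (Pi\<^sub>M ?I (\<lambda>_. borel))"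
    using measurable_compose[OF chain[OF order.refl] poly_meas] .
  ultimately have past: "?past \<in> borel_measurable (Pi\<^sub>M ?I (\<lambda>_. borel))"
    using prod by (intro borel_measurable_times)
  have "indep_var (Pi\<^sub>M ?I (\<lambda>_. borel)) (\<lambda>\<omega>. restrict (?X \<omega>) ?I)
      (Pi\<^sub>M {Suc m} (\<lambda>_. borel)) (\<lambda>\<omega>. restrict (?X \<omega>) {Suc m})"
    by (rule indep_var_restrict[OF indep]) auto
  from indep_var_compose[OF this past, of "\<lambda>x. x (Suc m)" borel]
  have "indep_var borel (?past \<circ> (\<lambda>\<omega>. restrict (?X \<omega>) ?I))
      borel ((\<lambda>x. x (Suc m)) \<circ> (\<lambda>\<omega>. restrict (?X \<omega>) {Suc m}))"
    by (simp add: measurable_component_singleton)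
  also have "?past \<circ> (\<lambda>\<omega>. restrict (?X \<omega>) ?I) =
      (\<lambda>\<omega>. indicator B (\<sigma>\<^sub>0 \<omega>) * (\<Prod>k<Suc m. \<xi> k \<omega>) * poly p (\<sigma> m \<omega>))"
    by (simp add: fun_eq_iff canonical_chain_restrict aux_seq_def)
  also have "(\<lambda>x. x (Suc m)) \<circ> (\<lambda>\<omega>. restrict (?X \<omega>) {Suc m}) = w m"
    by (simp add: fun_eq_iff)
  finally show ?thesis .
qed

lemma all_moments_past:
  assumes [measurable]: "B \<in> sets borel"
  shows "all_moments M (\<lambda>\<omega>. indicator B (\<sigma>\<^sub>0 \<omega>) * (\<Prod>k<m. \<xi> k \<omega>))"
  by (intro all_moments_mult all_moments_prod all_moments_aux all_moments_bounded[of _ 1])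
     (auto simp: indicator_def)

text \<open>The most recent noise variable is averaged out first, which leaves a dilated expansion at time
  \<open>m\<close>; the factor \<open>\<xi>\<^sub>m = \<mu> + \<sigma>\<^sub>m\<close> is absorbed into it, and the two effects together are one
  application of \<open>transfer\<close>. The indicator of \<open>\<sigma>\<^sub>0 \<in> B\<close> is carried along to test
  against the conditional expectation.\<close>
lemma expectation_chain_hermite_expansion:
  assumes B: "B \<in> sets borel"
  shows "expectation (\<lambda>\<omega>. indicator B (\<sigma>\<^sub>0 \<omega>) * (\<Prod>k<m. \<xi> k \<omega>) * poly (hermite_expansion c) (\<sigma> m \<omega>)) =
    expectation (\<lambda>\<omega>. indicator B (\<sigma>\<^sub>0 \<omega>) * poly (hermite_expansion ((transfer \<mu> \<rho> ^^ m) c)) (\<sigma>\<^sub>0 \<omega>))"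
proof (induction m arbitrary: c)
  case (Suc m)
  have "expectation (\<lambda>\<omega>. indicator B (\<sigma>\<^sub>0 \<omega>) * (\<Prod>k<Suc m. \<xi> k \<omega>) * poly (hermite_expansion c) (\<sigma> (Suc m) \<omega>)) =
      expectation (\<lambda>\<omega>. indicator B (\<sigma>\<^sub>0 \<omega>) * (\<Prod>k<Suc m. \<xi> k \<omega>) * poly (hermite_expansion (dilate \<rho> c)) (\<sigma> m \<omega>))"
    unfolding markov_chain.simps
    by (rule expectation_hermite_expansion_add_noise)
       (use rho in \<open>simp_all add: noise_normal all_moments_past all_moments_chain indep_past_noise B
          del: prod.lessThan_Suc\<close>)
  also have "\<dots> = expectation (\<lambda>\<omega>. indicator B (\<sigma>\<^sub>0 \<omega>) * (\<Prod>k<m. \<xi> k \<omega>) *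
      poly (hermite_expansion (transfer \<mu> \<rho> c)) (\<sigma> m \<omega>))"
    unfolding hermite_expansion_transfer poly_mult
    by (simp add: aux_seq_def mult.assoc)
  also have "\<dots> = expectation (\<lambda>\<omega>. indicator B (\<sigma>\<^sub>0 \<omega>) *
      poly (hermite_expansion ((transfer \<mu> \<rho> ^^ Suc m) c)) (\<sigma>\<^sub>0 \<omega>))"
    by (simp add: Suc.IH funpow_swap1)
  finally show ?case .
qed simp

text \<open>The polynomial on the right satisfies the defining property of the conditional expectation, by the
  previous lemma with \<open>c = 1\<close>. Almost sure equality passes from the law of \<open>\<sigma>\<^sub>0\<close> to Lebesgue
  measure since the normal density is positive.\<close>
lemma cond_exp_fun_AE_hermite_expansion:
  assumes Q: "is_cond_exp_fun M (\<lambda>\<omega>. \<Prod>k<N. \<xi> k \<omega>) \<sigma>\<^sub>0 q"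
  shows "AE x in lborel. q x = poly (hermite_expansion ((transfer \<mu> \<rho> ^^ N) 1)) x"
proof -
  let ?F = "vimage_algebra (space M) \<sigma>\<^sub>0 borel"
  let ?R = "hermite_expansion ((transfer \<mu> \<rho> ^^ N) 1)"
  have sub: "subalgebra M ?F"
    unfolding subalgebra_def by (auto simp: sets_vimage_algebra2)
  interpret F: finite_measure_subalgebra M ?F
    by unfold_locales (rule sub)
  have q_meas [measurable]: "q \<in> borel_measurable borel" using Q by (simp add: is_cond_exp_fun_def)
  have R_meas [measurable]: "poly ?R \<in> borel_measurable borel"
    by (intro borel_measurable_continuous_onI continuous_intros)
  have "AE \<omega> in M. real_cond_exp M ?F (\<lambda>\<omega>. \<Prod>k<N. \<xi> k \<omega>) \<omega> = poly ?R (\<sigma>\<^sub>0 \<omega>)"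
  proof (rule F.real_cond_exp_charact)
    show "integrable M (\<lambda>\<omega>. \<Prod>k<N. \<xi> k \<omega>)"
      by (intro all_moments_integrable all_moments_prod all_moments_aux)
    show "integrable M (\<lambda>\<omega>. poly ?R (\<sigma>\<^sub>0 \<omega>))"
      by (intro all_moments_integrable all_moments_poly all_moments_std_normal sigma0_normal)
    have "\<sigma>\<^sub>0 \<in> measurable ?F borel" by (rule measurable_vimage_algebra1) simp
    from measurable_compose[OF this R_meas]
    show "(\<lambda>\<omega>. poly ?R (\<sigma>\<^sub>0 \<omega>)) \<in> borel_measurable ?F" .
    fix A assume "A \<in> sets ?F"
    then obtain B where B: "B \<in> sets borel" and A: "A = \<sigma>\<^sub>0 -` B \<inter> space M"
      by (auto simp: sets_vimage_algebra2)
    have ind: "(LINT \<omega>:A|M. f \<omega>) = expectation (\<lambda>\<omega>. indicator B (\<sigma>\<^sub>0 \<omega>) * f \<omega>)" for f :: "'a \<Rightarrow> real"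
      unfolding set_lebesgue_integral_def A
      by (intro Bochner_Integration.integral_cong) (auto simp: indicator_def)
    show "(LINT \<omega>:A|M. \<Prod>k<N. \<xi> k \<omega>) = (LINT \<omega>:A|M. poly ?R (\<sigma>\<^sub>0 \<omega>))"
      using expectation_chain_hermite_expansion[OF B, of N 1]
      by (simp add: ind hermite_expansion_def[of 1])
  qed
  moreover have "AE \<omega> in M. q (\<sigma>\<^sub>0 \<omega>) = real_cond_exp M ?F (\<lambda>\<omega>. \<Prod>k<N. \<xi> k \<omega>) \<omega>"
    using Q by (simp add: is_cond_exp_fun_def)
  ultimately have "AE \<omega> in M. q (\<sigma>\<^sub>0 \<omega>) = poly ?R (\<sigma>\<^sub>0 \<omega>)"
    by eventually_elim simp
  then have "AE x in distr M lborel \<sigma>\<^sub>0. q x = poly ?R x"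
    by (subst AE_distr_iff) auto
  then have "AE x in density lborel std_normal_density. q x = poly ?R x"
    unfolding distributed_distr_eq_density[OF sigma0_normal] .
  then show ?thesis by (simp add: AE_density normal_density_pos)
qed

end

section \<open>The recurrence\<close>

text \<open>By orthogonality \<open>\<langle>Q\<^sub>N, h\<^sub>k\<rangle> = c\<^sub>k \<surd>k!\<close>, so the sum is \<open>\<Sum> c\<^sub>k t\<^sup>k\<close>; the degree bound ensures
  that cutting it off at \<open>N\<close> loses nothing.\<close>
lemma T_poly_eq:
  assumes [measurable]: "Q N \<in> borel_measurable borel"
    and ae: "AE x in lborel. Q N x = poly (hermite_expansion c) x" and deg: "degree c \<le> N"
  shows "T_poly Q N = poly c"
proof
  fix t
  have "gauss_inner (Q N) (hermite_normalized k) = coeff c k * sqrt (fact k)" for k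
  proof -
    have [measurable]: "poly p \<in> borel_measurable borel" for p :: "real poly"
      by (intro borel_measurable_continuous_onI continuous_intros)
    have "gauss_inner (Q N) (hermite_normalized k) =
        (LINT x|lborel. (std_normal_density x * poly (hermite_expansion c * hermite_poly k) x) / sqrt (fact k))"
      unfolding gauss_inner_def hermite_normalized_def hermite_eq_poly std_normal_density_def
    proof (rule integral_cong_AE)
      show "AE x in lborel. Q N x * (poly (hermite_poly k) x / sqrt (fact k)) * (exp (- x\<^sup>2 / 2) / sqrt (2 * pi)) =
          1 / sqrt (2 * pi) * exp (- x\<^sup>2 / 2) * poly (hermite_expansion c * hermite_poly k) x / sqrt (fact k)"
        using ae by eventually_elim (simp add: field_simps)
    qed measurable
    also have "\<dots> = fact k * coeff c k / sqrt (fact k)"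
      by (simp only: integral_divide_zero gauss_mean_def[symmetric] gauss_mean_hermite_expansion_mult)
    also have "\<dots> = coeff c k * (fact k / sqrt (fact k))" by simp
    also have "\<dots> = coeff c k * sqrt (fact k)" by (simp only: real_div_sqrt[OF fact_ge_zero])
    finally show ?thesis .
  qed
  then have "T_poly Q N t = (\<Sum>k\<le>N. coeff c k * t ^ k)"
    by (simp add: T_poly_def atMost_atLeast0)
  also have "\<dots> = poly c t"
    unfolding poly_altdef using deg by (intro sum.mono_neutral_right) (auto simp: coeff_eq_0)
  finally show "T_poly Q N t = poly c t" .
qed

theorem theorem12p1:
  fixes \<beta> \<alpha> V \<mu> \<rho> :: real
    and M :: "'a measure" and \<sigma>\<^sub>0 :: "'a \<Rightarrow> real" and w :: "nat \<Rightarrow> 'a \<Rightarrow> real"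
    and Q :: "nat \<Rightarrow> real \<Rightarrow> real"
    and P :: "'b measure" and X :: "'b \<Rightarrow> real"
  assumes "\<beta> > 0" and "\<alpha> > 0"
    and "\<mu> = exp (- \<beta> * V)" and "\<rho> = exp (- \<alpha> * \<beta>)"
    and "prob_space M" and "indep_std_normals M \<sigma>\<^sub>0 w"
    and "\<And>N. is_cond_exp_fun M (\<lambda>\<omega>. \<Prod>k<N. aux_seq \<mu> \<rho> \<sigma>\<^sub>0 w k \<omega>) \<sigma>\<^sub>0 (Q N)"
    and "prob_space P" and "distributed P lborel X std_normal_density"
  shows "\<forall>N t.
     T_poly Q N t = exp (- t\<^sup>2 / 2) * (LINT \<omega>|P. Q N (X \<omega>) * exp (t * X \<omega>)) \<and>
     T_poly Q (Suc N) t = (\<mu> + t) * T_poly Q N (\<rho> * t) + \<rho> * deriv (T_poly Q N) (\<rho> * t) \<and>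
     T_poly Q (Suc N) t =
       exp (- (\<mu> + t)\<^sup>2 / 2) * deriv (\<lambda>s. T_poly Q N (\<rho> * s) * exp ((\<mu> + s)\<^sup>2 / 2)) t"
proof (intro allI)
  fix N t
  have "\<rho>\<^sup>2 \<le> 1"
    using assms(1,2,4) by (simp add: abs_square_le_1)
  then interpret gaussian_chain M \<sigma>\<^sub>0 w \<mu> \<rho>
    using assms(5,6) by (simp add: gaussian_chain_def gaussian_chain_axioms_def)
  let ?c = "\<lambda>N. (transfer \<mu> \<rho> ^^ N) 1"
  have Q_meas [measurable]: "Q N \<in> borel_measurable borel" for N
    using assms(7)[of N] by (simp add: is_cond_exp_fun_def)
  have Q_AE: "AE x in lborel. Q N x = poly (hermite_expansion (?c N)) x" for N
    by (rule cond_exp_fun_AE_hermite_expansion) (rule assms(7))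
  have T: "T_poly Q N = poly (?c N)" for N
    by (rule T_poly_eq[OF Q_meas Q_AE degree_transfer_iterate])
  have poly_meas [measurable]: "poly p \<in> borel_measurable borel" for p :: "real poly"
    by (intro borel_measurable_continuous_onI continuous_intros)
  have "(LINT \<omega>|P. Q N (X \<omega>) * exp (t * X \<omega>)) =
      (LINT x|lborel. std_normal_density x * (Q N x * exp (t * x)))"
    by (rule distributed_integral[OF assms(9), symmetric]) auto
  also have "\<dots> = (LINT x|lborel. std_normal_density x * (poly (hermite_expansion (?c N)) x * exp (t * x)))"
  proof (rule integral_cong_AE)
    show "AE x in lborel. std_normal_density x * (Q N x * exp (t * x)) =
        std_normal_density x * (poly (hermite_expansion (?c N)) x * exp (t * x))"
      using Q_AE[of N] by eventually_elim simp
  qed measurable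
  also have "\<dots> = exp (t\<^sup>2 / 2) * poly (?c N) t"
    by (simp add: gauss_laplace_poly gauss_mean_hermite_expansion_shift)
  finally have lap: "T_poly Q N t = exp (- t\<^sup>2 / 2) * (LINT \<omega>|P. Q N (X \<omega>) * exp (t * X \<omega>))"
    by (simp add: T mult_exp_exp flip: mult.assoc)
  have rec: "T_poly Q (Suc N) t = (\<mu> + t) * T_poly Q N (\<rho> * t) + \<rho> * deriv (T_poly Q N) (\<rho> * t)"
    unfolding T by (simp add: poly_transfer DERIV_imp_deriv[OF poly_DERIV])
  have "((\<lambda>s. T_poly Q N (\<rho> * s) * exp ((\<mu> + s)\<^sup>2 / 2)) has_real_derivative
      exp ((\<mu> + t)\<^sup>2 / 2) * T_poly Q (Suc N) t) (at t)"
    unfolding T funpow.simps o_apply poly_transfer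
    by (auto intro!: derivative_eq_intros DERIV_chain'[OF _ poly_DERIV] simp: algebra_simps)
  then have "T_poly Q (Suc N) t =
      exp (- (\<mu> + t)\<^sup>2 / 2) * deriv (\<lambda>s. T_poly Q N (\<rho> * s) * exp ((\<mu> + s)\<^sup>2 / 2)) t"
    by (simp add: DERIV_imp_deriv mult_exp_exp flip: mult.assoc)
  with lap rec show "T_poly Q N t = exp (- t\<^sup>2 / 2) * (LINT \<omega>|P. Q N (X \<omega>) * exp (t * X \<omega>)) \<and>
     T_poly Q (Suc N) t = (\<mu> + t) * T_poly Q N (\<rho> * t) + \<rho> * deriv (T_poly Q N) (\<rho> * t) \<and>
     T_poly Q (Suc N) t =
       exp (- (\<mu> + t)\<^sup>2 / 2) * deriv (\<lambda>s. T_poly Q N (\<rho> * s) * exp ((\<mu> + s)\<^sup>2 / 2)) t"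
    by blast
qed

end
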